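(* There exists a function $f\in\mathcal{B}^{\mathrm{mock}}(\mathbb{D})$ which is not in $\mathcal{B}(\mathbb{D})$.
   Context: $\mathbb{D}=\{z\in\mathbb{C}:|z|<1\}$; $dA=\frac1\pi\,dx\,dy$ is normalized area measure; $L^2(\mathbb{D})$ is the complex $L^2$ space with respect to $dA$, with $\langle f,g\rangle_{\mathbb{D}}=\int_{\mathbb{D}}f\,\bar g\,dA$. For $z\in\mathbb{D}$, $\mathrm{s}_z(\zeta)=\frac{1}{1-\bar z\zeta}$, and $\bar{\mathrm{s}}_z$ is the function $\zeta\mapsto\overline{\mathrm{s}_z(\zeta)}$. For a bounded $\mathbb{C}$-linear operator $\mathbf{T}$ on $L^2(\mathbb{D})$, its Dirichlet operator symbol is the holomorphic function on $\mathbb{D}^2$ given by $\mathcal{P}[\mathbf{T}](z,w)=\langle\mathbf{T}\,\bar{\mathrm{s}}_z,\mathrm{s}_w\rangle_{\mathbb{D}}$, with diagonal restriction $\oslash\mathcal{P}[\mathbf{T}](z)=\langle\mathbf{T}\,\bar{\mathrm{s}}_z,\mathrm{s}_z\rangle_{\mathbb{D}}$, $z\in\mathbb{D}$. The mock-Bloch space is \[ \mathcal{B}^{\mathrm{mock}}(\mathbb{D})=\big\{\oslash\mathcal{P}[\mathbf{T}]:\ \mathbf{T}\text{ is a bounded operator on }L^2(\mathbb{D})\big\}. \] The Bloch space $\mathcal{B}(\mathbb{D})$ consists of all holomorphic $f:\mathbb{D}\to\mathbb{C}$ with $\sup_{z\in\mathbb{D}}(1-|z|^2)|f'(z)|<+\infty$.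 *)

theory Defs
  imports "HOL-Complex_Analysis.Complex_Analysis"
begin

definition disc_area :: "complex measure" where
  "disc_area = density (restrict_space lborel (ball 0 1)) (\<lambda>_. ennreal (1 / pi))"

text \<open>
  Elements of $L^2$ of the disc are represented by square-integrable functions, with
  almost-everywhere equality in place of equality. Only the values on the unit disc matter.
\<close>

definition L2_disc :: "(complex \<Rightarrow> complex) set" where
  "L2_disc = {f \<in> borel_measurable disc_area. integrable disc_area (\<lambda>\<zeta>. (cmod (f \<zeta>))\<^sup>2)}"

definition inner_disc :: "(complex \<Rightarrow> complex) \<Rightarrow> (complex \<Rightarrow> complex) \<Rightarrow> complex" where
  "inner_disc f g = (\<integral>\<zeta>. f \<zeta> * cnj (g \<zeta>) \<partial>disc_area)"

definition norm_disc :: "(complex \<Rightarrow> complex) \<Rightarrow> real" where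
  "norm_disc f = sqrt (\<integral>\<zeta>. (cmod (f \<zeta>))\<^sup>2 \<partial>disc_area)"

text \<open>
  A bounded operator acts on representatives, and is linear up to null sets. That it
  descends to almost-everywhere classes is a consequence, see \<open>bounded_operator_L2_AE_cong\<close>
  below; conversely, every bounded operator on classes arises in this way by choosing
  representatives.
\<close>

definition bounded_operator_L2 :: "((complex \<Rightarrow> complex) \<Rightarrow> (complex \<Rightarrow> complex)) \<Rightarrow> bool" where
  "bounded_operator_L2 T \<longleftrightarrow>
     (\<forall>f\<in>L2_disc. T f \<in> L2_disc) \<and>
     (\<forall>f\<in>L2_disc. \<forall>g\<in>L2_disc. AE \<zeta> in disc_area. T (\<lambda>x. f x + g x) \<zeta> = T f \<zeta> + T g \<zeta>) \<and>
     (\<forall>c. \<forall>f\<in>L2_disc. AE \<zeta> in disc_area. T (\<lambda>x. c * f x) \<zeta> = c * T f \<zeta>) \<and>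
     (\<exists>C. \<forall>f\<in>L2_disc. norm_disc (T f) \<le> C * norm_disc f)"

definition szego :: "complex \<Rightarrow> complex \<Rightarrow> complex" where
  "szego z \<zeta> = 1 / (1 - cnj z * \<zeta>)"

definition dirichlet_symbol ::
    "((complex \<Rightarrow> complex) \<Rightarrow> (complex \<Rightarrow> complex)) \<Rightarrow> complex \<Rightarrow> complex \<Rightarrow> complex" where
  "dirichlet_symbol T z w = inner_disc (T (\<lambda>\<zeta>. cnj (szego z \<zeta>))) (szego w)"

text \<open>
  Functions on the disc are total functions whose values off the disc are unconstrained;
  membership in each of the two spaces below depends only on the restriction to the disc.
\<close>

definition mock_bloch :: "(complex \<Rightarrow> complex) set" where
  "mock_bloch = {f. \<exists>T. bounded_operator_L2 T \<and> (\<forall>z\<in>ball 0 1. f z = dirichlet_symbol T z z)}"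

definition bloch :: "(complex \<Rightarrow> complex) set" where
  "bloch = {f. f holomorphic_on ball 0 1 \<and>
               bdd_above ((\<lambda>z. (1 - (cmod z)\<^sup>2) * cmod (deriv f z)) ` ball 0 1)}"

lemma L2_disc_cmult:
  assumes "f \<in> L2_disc"
  shows "(\<lambda>x. c * f x) \<in> L2_disc"
  using assms by (auto simp: L2_disc_def norm_mult power_mult_distrib)

lemma L2_disc_add:
  assumes "f \<in> L2_disc" "g \<in> L2_disc"
  shows "(\<lambda>x. f x + g x) \<in> L2_disc"
proof -
  have [measurable]: "f \<in> borel_measurable disc_area" "g \<in> borel_measurable disc_area"
    using assms by (auto simp: L2_disc_def)
  have int: "integrable disc_area (\<lambda>x. 2 * (cmod (f x))\<^sup>2 + 2 * (cmod (g x))\<^sup>2)"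
    using assms by (intro Bochner_Integration.integrable_add integrable_mult_right)
      (simp_all add: L2_disc_def)
  have le: "(cmod (f x + g x))\<^sup>2 \<le> 2 * (cmod (f x))\<^sup>2 + 2 * (cmod (g x))\<^sup>2" for x
  proof -
    have "(cmod (f x + g x))\<^sup>2 \<le> (cmod (f x) + cmod (g x))\<^sup>2"
      by (intro power_mono norm_triangle_ineq) simp
    also have "\<dots> \<le> 2 * (cmod (f x))\<^sup>2 + 2 * (cmod (g x))\<^sup>2"
      using zero_le_power2[of "cmod (f x) - cmod (g x)"]
      unfolding power2_sum power2_diff by linarith
    finally show ?thesis .
  qed
  have "integrable disc_area (\<lambda>x. (cmod (f x + g x))\<^sup>2)"
  proof (rule Bochner_Integration.integrable_bound[OF int])
    show "AE x in disc_area. norm ((cmod (f x + g x))\<^sup>2)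
        \<le> norm (2 * (cmod (f x))\<^sup>2 + 2 * (cmod (g x))\<^sup>2)"
      using le by (intro AE_I2) (simp add: abs_of_nonneg)
  qed measurable
  then show ?thesis
    by (auto simp: L2_disc_def)
qed

lemma bounded_operator_L2_AE_cong:
  assumes T: "bounded_operator_L2 T" and f: "f \<in> L2_disc" and g: "g \<in> L2_disc"
    and eq: "AE \<zeta> in disc_area. f \<zeta> = g \<zeta>"
  shows "AE \<zeta> in disc_area. T f \<zeta> = T g \<zeta>"
proof -
  define h where "h = (\<lambda>x. f x + (-1) * g x)"
  have h: "h \<in> L2_disc"
    unfolding h_def by (intro L2_disc_add f L2_disc_cmult g)
  have "norm_disc h = 0"
  proof -
    have "(\<integral>\<zeta>. (cmod (h \<zeta>))\<^sup>2 \<partial>disc_area) = 0"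
      using eq by (intro integral_eq_zero_AE) (auto simp: h_def elim!: eventually_mono)
    then show ?thesis
      by (simp add: norm_disc_def)
  qed
  moreover obtain C where "norm_disc (T h) \<le> C * norm_disc h"
    using T h unfolding bounded_operator_L2_def by blast
  moreover have "T h \<in> L2_disc"
    using T h unfolding bounded_operator_L2_def by blast
  ultimately have le: "(\<integral>\<zeta>. (cmod (T h \<zeta>))\<^sup>2 \<partial>disc_area) \<le> 0"
    and int: "integrable disc_area (\<lambda>\<zeta>. (cmod (T h \<zeta>))\<^sup>2)"
    by (simp_all add: norm_disc_def L2_disc_def)
  have "0 \<le> (\<integral>\<zeta>. (cmod (T h \<zeta>))\<^sup>2 \<partial>disc_area)"
    by (rule Bochner_Integration.integral_nonneg) simp
  with le have "(\<integral>\<zeta>. (cmod (T h \<zeta>))\<^sup>2 \<partial>disc_area) = 0"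
    by linarith
  then have "AE \<zeta> in disc_area. (cmod (T h \<zeta>))\<^sup>2 = 0"
    using integral_nonneg_eq_0_iff_AE[OF int] by simp
  then have Th: "AE \<zeta> in disc_area. T h \<zeta> = 0"
    by simp
  have "AE \<zeta> in disc_area. T (\<lambda>x. h x + g x) \<zeta> = T h \<zeta> + T g \<zeta>"
    using T h g unfolding bounded_operator_L2_def by blast
  moreover have "(\<lambda>x. h x + g x) = f"
    by (auto simp: h_def)
  ultimately show ?thesis
    using Th by auto
qed

end

theory Submission
  imports Defs
begin

text \<open>
  The functions \<open>\<zeta> ^ n\<close> are orthogonal in $L^2$ of the disc with squared norm \<open>1 / (n + 1)\<close>, so a bounded
  matrix \<open>t\<close> has diagonal symbol $\sum_{n,m} t_{nm} z^{n+m} / \sqrt{(n+1)(m+1)}$. A rank one operator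
  pairing the exponents in \<open>{M..<2 * M}\<close> with those in a much longer interval below \<open>2 * M\<close>, whose
  harmonic sum is \<open>H\<close>, can have norm at most \<open>1\<close> and yet a symbol whose derivative at \<open>1 - 1 / (8 * M)\<close>
  is of order \<open>M * sqrt H\<close>; a Bloch function allows only order \<open>M\<close>. Using disjoint blocks of exponents
  with \<open>H\<close> tending to infinity, the sum of these rank one operators is still a contraction, and
  since all the coefficients of its symbol are nonnegative, the blocks cannot cancel on the positive real axis.
\<close>

section \<open>Area measure on the disc\<close>

text \<open>A measure giving every box its volume is \<open>lborel\<close>, so only boxes have to be
  checked. Orthogonal maps preserve the Lebesgue measure of images; applying this to
  \<open>inv f\<close> treats the preimages that occur in \<open>distr\<close>.\<close>

lemma lborel_distr_orthogonal:
  fixes f :: "real^'n::{finite,wellorder} \<Rightarrow> real^'n::_"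
  assumes f: "orthogonal_transformation f"
  shows "distr lborel borel f = lborel"
proof (rule lborel_eqI[symmetric])
  have inv: "orthogonal_transformation (inv f)"
    using f by (rule orthogonal_transformation_inv)
  have bij: "bij f"
    using f by (rule orthogonal_transformation_bij)
  have meas: "f \<in> borel_measurable borel"
    using f by (intro borel_measurable_continuous_onI linear_continuous_on linear_conv_bounded_linear[THEN iffD1]
        orthogonal_transformation_linear)
  fix l u :: "real^'n::_"
  assume lu: "\<And>b. b \<in> Basis \<Longrightarrow> l \<bullet> b \<le> u \<bullet> b"
  have box: "box l u \<in> lmeasurable"
    by simp
  have vim: "f -` box l u = inv f ` box l u"
    using bij by (rule bij_vimage_eq_inv_image)
  have lm: "inv f ` box l u \<in> lmeasurable"
    using inv box by (rule measurable_orthogonal_image)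
  have bor: "inv f ` box l u \<in> sets borel"
    using measurable_sets[OF meas, of "box l u"] vim by simp
  have "emeasure (distr lborel borel f) (box l u) = emeasure lborel (inv f ` box l u)"
    using meas vim by (simp add: emeasure_distr)
  also have "\<dots> = emeasure lebesgue (inv f ` box l u)"
    using bor by simp
  also have "\<dots> = ennreal (measure lebesgue (inv f ` box l u))"
    using lm by (simp add: emeasure_eq_measure2)
  also have "measure lebesgue (inv f ` box l u) = measure lebesgue (box l u)"
    using inv box by (rule measure_orthogonal_image)
  also have "ennreal \<dots> = (\<Prod>b\<in>Basis. (u - l) \<bullet> b)"
    using lu by simp
  finally show "emeasure (distr lborel borel f) (box l u) = (\<Prod>b\<in>Basis. (u - l) \<bullet> b)" .
qed simp

text \<open>Transports invariance under orthogonal maps from \<open>real^2\<close> to the complex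
  plane; preimages of boxes are boxes with the same side lengths.\<close>

lemma lborel_distr_Complex:
  "distr lborel borel (\<lambda>x::real^2. Complex (x $ 1) (x $ 2)) = lborel"
proof (rule lborel_eqI[symmetric])
  let ?h = "\<lambda>x::real^2. Complex (x $ 1) (x $ 2)"
  have meas: "?h \<in> borel_measurable borel"
    by (simp add: borel_measurable_complex_iff)
  fix l u :: complex
  assume lu: "\<And>b. b \<in> Basis \<Longrightarrow> l \<bullet> b \<le> u \<bullet> b"
  let ?l = "vector [Re l, Im l] :: real^2" and ?u = "vector [Re u, Im u] :: real^2"
  have vim: "?h -` box l u = box ?l ?u"
    by (auto simp: mem_box_cart in_box_complex_iff forall_2 vector_2)
  have "emeasure (distr lborel borel ?h) (box l u) = emeasure lborel (box ?l ?u)"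
    using meas vim by (simp add: emeasure_distr)
  also have "\<dots> = (\<Prod>b\<in>Basis. (?u - ?l) \<bullet> b)"
  proof (rule emeasure_lborel_box)
    fix b :: "real^2" assume "b \<in> Basis"
    then show "?l \<bullet> b \<le> ?u \<bullet> b"
      using lu[of 1] lu[of \<i>] by (auto simp: Basis_vec_def inner_axis UNIV_2 vector_2 Basis_complex_def)
  qed
  also have "(\<Prod>b\<in>Basis. (?u - ?l) \<bullet> b) = (\<Prod>b\<in>Basis. (u - l) \<bullet> b)"
    by (simp add: Basis_complex_def Basis_real_def  prod.UNION_disjoint Basis_vec_def UNIV_2 axis_eq_axis inner_axis vector_2)
  finally show "emeasure (distr lborel borel ?h) (box l u) = (\<Prod>b\<in>Basis. (u - l) \<bullet> b)" .
qed simp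

text \<open>In real coordinates multiplication by \<open>u\<close> is the rotation matrix
  \<open>R\<close>, which preserves inner products because its columns have length
  \<open>cmod u = 1\<close>.\<close>

lemma lborel_distr_rotation:
  assumes u: "cmod u = 1"
  shows "distr lborel borel ((*) u) = lborel"
proof -
  let ?h = "\<lambda>x::real^2. Complex (x $ 1) (x $ 2)"
  define R where "R = (\<lambda>x::real^2. vector [Re u * x $ 1 - Im u * x $ 2, Re u * x $ 2 + Im u * x $ 1] :: real^2)"
  have uu: "Re u * Re u + Im u * Im u = 1"
    using u by (simp add: cmod_def power2_eq_square)
  have lin: "linear R"
    by (rule linearI) (auto simp: R_def vec_eq_iff forall_2 vector_2 algebra_simps)
  moreover have "R v \<bullet> R w = v \<bullet> w" for v w
  proof -
    have "R v \<bullet> R w = (Re u * Re u + Im u * Im u) * (v \<bullet> w)"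
      by (simp add: R_def inner_vec_def sum_2 vector_2 algebra_simps)
    then show ?thesis
      using uu by simp
  qed
  ultimately have "orthogonal_transformation R"
    by (simp add: orthogonal_transformation_def)
  then have R: "distr lborel borel R = lborel"
    by (rule lborel_distr_orthogonal)
  have [measurable]: "?h \<in> borel_measurable borel"
    by (simp add: borel_measurable_complex_iff)
  have [measurable]: "R \<in> borel_measurable borel"
    using lin by (intro borel_measurable_continuous_onI linear_continuous_on linear_conv_bounded_linear[THEN iffD1])
  have comm: "(*) u \<circ> ?h = ?h \<circ> R"
    by (auto simp: fun_eq_iff R_def complex_eq_iff vector_2)
  have "distr lborel borel ((*) u) = distr (distr lborel borel ?h) borel ((*) u)"
    by (simp add: lborel_distr_Complex)
  also have "\<dots> = distr lborel borel ((*) u \<circ> ?h)"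
    by (rule distr_distr) auto
  also have "\<dots> = distr (distr lborel borel R) borel ?h"
    unfolding comm by (rule distr_distr[symmetric]) auto
  also have "\<dots> = lborel"
    by (simp add: R lborel_distr_Complex)
  finally show ?thesis .
qed

section \<open>Normalized area as a probability measure on the disc\<close>

lemma space_disc_area [simp]: "space disc_area = ball 0 1"
  by (simp add: disc_area_def space_restrict_space)

lemma sets_disc_area: "sets disc_area = sets (restrict_space borel (ball 0 1))"
  by (simp add: disc_area_def sets_restrict_space)

lemma borel_measurable_disc_area:
  fixes f :: "complex \<Rightarrow> 'a::topological_space"
  assumes "f \<in> borel_measurable borel"
  shows "f \<in> borel_measurable disc_area"
  using measurable_restrict_space1[OF assms, of "ball 0 1"]
  by (simp cong: measurable_cong_sets add: measurable_cong_sets[OF sets_disc_area refl])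

lemma borel_measurable_disc_area_ident [measurable]: "(\<lambda>\<zeta>. \<zeta>) \<in> borel_measurable disc_area"
  by (rule borel_measurable_disc_area) simp

lemma borel_measurable_cnj [measurable]: "cnj \<in> borel_measurable borel"
  by (intro borel_measurable_continuous_onI continuous_intros)

lemma continuous_on_borel_measurable_disc_area:
  fixes f :: "complex \<Rightarrow> 'a::topological_space"
  assumes "continuous_on (ball 0 1) f"
  shows "f \<in> borel_measurable disc_area"
  using borel_measurable_continuous_on_restrict[OF assms]
  by (simp add: measurable_cong_sets[OF sets_disc_area refl])

lemma emeasure_disc_area:
  assumes "A \<in> sets borel"
  shows "emeasure disc_area (A \<inter> ball 0 1) = ennreal (1 / pi) * emeasure lborel (A \<inter> ball 0 1)"
proof -
  have A: "A \<inter> ball 0 1 \<in> sets (restrict_space lborel (ball 0 1))"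
    using assms by (auto simp: sets_restrict_space)
  have "emeasure disc_area (A \<inter> ball 0 1) =
      ennreal (1 / pi) * emeasure (restrict_space lborel (ball 0 1)) (A \<inter> ball 0 1)"
    unfolding disc_area_def using A by (rule emeasure_density_const)
  then show ?thesis
    by (simp add: emeasure_restrict_space)
qed

lemma emeasure_lborel_complex_cball:
  assumes "r \<ge> 0"
  shows "emeasure lborel (cball (c::complex) r) = ennreal (pi * r\<^sup>2)"
  using emeasure_cball[OF assms, of c] by (simp add: unit_ball_vol_2)

lemma emeasure_lborel_complex_ball:
  assumes "r \<ge> 0"
  shows "emeasure lborel (ball (c::complex) r) = ennreal (pi * r\<^sup>2)"
  using emeasure_ball[OF assms, of c] by (simp add: unit_ball_vol_2)

lemma emeasure_disc_area_space: "emeasure disc_area (ball 0 1) = 1"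
  using emeasure_disc_area[of UNIV]
  by (simp add: emeasure_lborel_complex_ball ennreal_mult[symmetric])

lemma finite_measure_disc_area: "finite_measure disc_area"
  by (rule finite_measureI) (simp add: emeasure_disc_area_space)

lemma integrable_disc_area_bounded:
  fixes f :: "complex \<Rightarrow> 'a::{banach, second_countable_topology}"
  assumes "f \<in> borel_measurable disc_area" "\<And>\<zeta>. cmod \<zeta> < 1 \<Longrightarrow> norm (f \<zeta>) \<le> B"
  shows "integrable disc_area f"
  using assms by (intro finite_measure.integrable_const_bound[OF finite_measure_disc_area, of f B]) auto

lemma integral_disc_area:
  fixes f :: "complex \<Rightarrow> complex"
  assumes "f \<in> borel_measurable borel"
  shows "(\<integral>\<zeta>. f \<zeta> \<partial>disc_area) = (\<integral>\<zeta>. indicator (ball 0 1) \<zeta> *\<^sub>R f \<zeta> \<partial>lborel) / pi"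
proof -
  have "(\<integral>\<zeta>. f \<zeta> \<partial>disc_area) = (\<integral>\<zeta>. (1 / pi) *\<^sub>R f \<zeta> \<partial>restrict_space lborel (ball 0 1))"
    unfolding disc_area_def using assms by (intro integral_density) (auto intro: measurable_restrict_space1)
  also have "\<dots> = (1 / pi) *\<^sub>R (\<integral>\<zeta>. f \<zeta> \<partial>restrict_space lborel (ball 0 1))"
    by simp
  also have "(\<integral>\<zeta>. f \<zeta> \<partial>restrict_space lborel (ball 0 1)) = (\<integral>\<zeta>. indicator (ball 0 1) \<zeta> *\<^sub>R f \<zeta> \<partial>lborel)"
    by (subst integral_restrict_space) auto
  finally show ?thesis
    by (simp add: scaleR_conv_of_real)
qed

text \<open>The disc is mapped to itself by rotations, so its area measure inherits their
  invariance. This replaces angular integration in the orthogonality of monomials.\<close>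

lemma integral_disc_area_rotation:
  fixes f :: "complex \<Rightarrow> complex"
  assumes [measurable]: "f \<in> borel_measurable borel" and u: "cmod u = 1"
  shows "(\<integral>\<zeta>. f (u * \<zeta>) \<partial>disc_area) = (\<integral>\<zeta>. f \<zeta> \<partial>disc_area)"
proof -
  let ?g = "\<lambda>\<zeta>. indicator (ball 0 1) \<zeta> *\<^sub>R f \<zeta>"
  have "(\<integral>\<zeta>. ?g \<zeta> \<partial>lborel) = (\<integral>\<zeta>. ?g \<zeta> \<partial>distr lborel borel ((*) u))"
    by (simp add: lborel_distr_rotation[OF u])
  also have "\<dots> = (\<integral>\<zeta>. ?g (u * \<zeta>) \<partial>lborel)"
    by (rule integral_distr) (auto intro!: borel_measurable_scaleR borel_measurable_indicator)
  also have "\<dots> = (\<integral>\<zeta>. indicator (ball 0 1) \<zeta> *\<^sub>R f (u * \<zeta>) \<partial>lborel)"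
    using u by (intro Bochner_Integration.integral_cong) (auto simp: indicator_def norm_mult)
  finally show ?thesis
    by (simp add: integral_disc_area)
qed

section \<open>Moments of monomials on the disc\<close>

text \<open>The disc of radius \<open>sqrt x\<close> has normalized area \<open>x\<close>, so the
  squared modulus is uniformly distributed on the unit interval. This stands in for radial
  integration; comparison on half-lines suffices.\<close>

lemma distr_disc_area_cmod_sq:
  "distr disc_area borel (\<lambda>\<zeta>. (cmod \<zeta>)\<^sup>2) = density lborel (indicator {0..1})"
proof (rule measure_eqI_lessThan)
  let ?D = "distr disc_area borel (\<lambda>\<zeta>. (cmod \<zeta>)\<^sup>2)"
  show "emeasure ?D {x<..} = emeasure (density lborel (indicator {0..1})) {x<..}" for x
  proof -
    have R: "emeasure (density lborel (indicator {0..1})) {x<..} = emeasure lborel ({0..1} \<inter> {x<..})"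
      by (subst emeasure_density) (auto simp flip: indicator_inter_arith)
    have L: "emeasure ?D {x<..} = emeasure disc_area ({\<zeta>. x < (cmod \<zeta>)\<^sup>2} \<inter> ball 0 1)"
      by (subst emeasure_distr) (auto simp: vimage_def)
    consider "x < 0" | "0 \<le> x" "x < 1" | "x \<ge> 1"
      by linarith
    then show ?thesis
    proof cases
      case 1
      have "x < (cmod \<zeta>)\<^sup>2" for \<zeta> :: complex
        using 1 zero_le_power2[of "cmod \<zeta>"] by linarith
      moreover have "{0..1} \<inter> {x<..} = {0..1}"
        using 1 by auto
      ultimately show ?thesis
        unfolding L R by (simp add: emeasure_disc_area_space)
    next
      case 2
      have sq: "x < (cmod \<zeta>)\<^sup>2 \<longleftrightarrow> sqrt x < cmod \<zeta>" for \<zeta> :: complex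
        using real_sqrt_less_iff[of x "(cmod \<zeta>)\<^sup>2"] by simp
      \<comment> \<open>The set is an annulus, so its area is a difference of two disc
        areas.\<close>
      have eq: "{\<zeta>. x < (cmod \<zeta>)\<^sup>2} \<inter> ball 0 1 = ball 0 1 - cball 0 (sqrt x)"
        by (auto simp: sq)
      have sub: "cball 0 (sqrt x) \<subseteq> ball (0::complex) 1"
        using 2 by (intro cball_subset_ball_iff[THEN iffD2]) auto
      have "emeasure disc_area ({\<zeta>. x < (cmod \<zeta>)\<^sup>2} \<inter> ball 0 1)
          = ennreal (1 / pi) * emeasure lborel (ball 0 1 - cball 0 (sqrt x) :: complex set)"
        by (subst emeasure_disc_area) (auto simp: eq)
      also have "emeasure lborel (ball 0 1 - cball 0 (sqrt x) :: complex set) = ennreal (pi - pi * x)"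
        using 2 sub by (subst emeasure_Diff)
          (auto simp: emeasure_lborel_complex_ball emeasure_lborel_complex_cball ennreal_minus)
      also have "ennreal (1 / pi) * ennreal (pi - pi * x) = ennreal (1 - x)"
        using 2 by (subst ennreal_mult[symmetric]) (auto simp: field_simps)
      moreover have "{0..1} \<inter> {x<..} = {x<..1}"
        using 2 by auto
      ultimately show ?thesis
        unfolding L R using 2 by simp
    next
      case 3
      have "\<not> x < (cmod \<zeta>)\<^sup>2" if "cmod \<zeta> < 1" for \<zeta> :: complex
        using that 3 power_le_one[of "cmod \<zeta>" 2] by auto
      then have "{\<zeta>. x < (cmod \<zeta>)\<^sup>2} \<inter> ball 0 1 = {}"
        by auto
      moreover have "{0..1} \<inter> {x<..} = {}"
        using 3 by auto
      ultimately show ?thesis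
        unfolding L R by simp
    qed
  qed
  show "emeasure ?D {x<..} < \<infinity>" for x
    by (subst emeasure_distr) (auto simp: less_top[symmetric] intro!: finite_measure.emeasure_finite[OF finite_measure_disc_area])
qed auto

lemma integral_disc_area_cmod_power:
  "(\<integral>\<zeta>. (cmod \<zeta>) ^ (2 * n) \<partial>disc_area) = 1 / (real n + 1)"
proof -
  have "(\<integral>\<zeta>. (cmod \<zeta>) ^ (2 * n) \<partial>disc_area) = (\<integral>x. x ^ n \<partial>distr disc_area borel (\<lambda>\<zeta>. (cmod \<zeta>)\<^sup>2))"
    by (subst integral_distr) (auto simp: power_mult)
  also have "\<dots> = (\<integral>x. x ^ n \<partial>density lborel (\<lambda>x. ennreal (indicator {0..1} x)))"
    unfolding distr_disc_area_cmod_sq by (simp add: ennreal_indicator)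
  also have "\<dots> = (\<integral>x. x ^ n * indicator {0..1} x \<partial>lborel)"
    by (subst integral_density) (auto simp: mult.commute)
  also have "\<dots> = 1 / (real n + 1)"
    by (subst integral_power) (auto simp: add.commute)
  finally show ?thesis .
qed

lemma integral_disc_area_monomials:
  "(\<integral>\<zeta>. \<zeta> ^ n * cnj \<zeta> ^ m \<partial>disc_area) = (if n = m then 1 / (of_nat n + 1) else 0)"
proof (cases "n = m")
  case True
  have "(\<integral>\<zeta>. \<zeta> ^ n * cnj \<zeta> ^ m \<partial>disc_area) = (\<integral>\<zeta>. complex_of_real ((cmod \<zeta>) ^ (2 * n)) \<partial>disc_area)"
    using True by (intro Bochner_Integration.integral_cong)
      (auto simp flip: power_mult_distrib simp: complex_norm_square[symmetric] power_mult)
  also have "\<dots> = of_real (1 / (real n + 1))"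
    by (simp only: integral_complex_of_real integral_disc_area_cmod_power)
  finally show ?thesis
    using True by simp
next
  case False
  let ?I = "\<integral>\<zeta>. \<zeta> ^ n * cnj \<zeta> ^ m \<partial>disc_area"
  \<comment> \<open>A rotation by the angle \<open>t\<close> multiplies the integrand by
    \<open>cis ((n - m) * t) = cis pi = -1\<close>, while invariance leaves the integral
    unchanged.\<close>
  define t where "t = pi / (real n - real m)"
  let ?u = "cis t"
  have "?I = (\<integral>\<zeta>. (?u * \<zeta>) ^ n * cnj (?u * \<zeta>) ^ m \<partial>disc_area)"
    by (rule integral_disc_area_rotation[symmetric])
      (auto intro!: borel_measurable_continuous_onI continuous_intros)
  also have "\<dots> = (\<integral>\<zeta>. (?u ^ n * cnj ?u ^ m) * (\<zeta> ^ n * cnj \<zeta> ^ m) \<partial>disc_area)"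
    by (simp add: power_mult_distrib mult_ac)
  also have "\<dots> = (?u ^ n * cnj ?u ^ m) * ?I"
    by (rule integral_mult_right_zero)
  also have "?u ^ n * cnj ?u ^ m = cis (real n * t - real m * t)"
    by (simp add: Complex.DeMoivre cis_cnj cis_mult)
  also have "real n * t - real m * t = pi"
    unfolding left_diff_distrib[symmetric] using False by (simp add: t_def)
  finally have "?I = - ?I"
    by simp
  then show ?thesis
    using False by simp
qed

section \<open>Orthogonal series of operators\<close>

lemma L2_disc_integrable:
  assumes "f \<in> L2_disc" "g \<in> L2_disc"
  shows "integrable disc_area (\<lambda>\<zeta>. f \<zeta> * cnj (g \<zeta>))"
proof -
  have [measurable]: "f \<in> borel_measurable disc_area" "g \<in> borel_measurable disc_area"
    using assms by (auto simp: L2_disc_def)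
  have "integrable disc_area (\<lambda>x. (cmod (f x))\<^sup>2 + (cmod (g x))\<^sup>2)"
    using assms by (intro Bochner_Integration.integrable_add) (simp_all add: L2_disc_def)
  then show ?thesis
  proof (rule Bochner_Integration.integrable_bound)
    have "cmod (f x) * cmod (g x) \<le> (cmod (f x))\<^sup>2 + (cmod (g x))\<^sup>2" for x
      using sum_squares_bound[of "cmod (f x)" "cmod (g x)"]
        mult_nonneg_nonneg[OF norm_ge_zero[of "f x"] norm_ge_zero[of "g x"]] by linarith
    then show "AE x in disc_area. norm (f x * cnj (g x)) \<le> norm ((cmod (f x))\<^sup>2 + (cmod (g x))\<^sup>2)"
      by (intro AE_I2) (simp add: norm_mult)
  qed measurable
qed

lemma L2_disc_bounded:
  assumes f: "f \<in> borel_measurable disc_area" and B: "\<And>\<zeta>. cmod \<zeta> < 1 \<Longrightarrow> cmod (f \<zeta>) \<le> B"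
  shows "f \<in> L2_disc"
proof -
  have "integrable disc_area (\<lambda>\<zeta>. (cmod (f \<zeta>))\<^sup>2)"
    using f by (intro integrable_disc_area_bounded[where B = "B\<^sup>2"]) (auto intro!: power_mono B)
  then show ?thesis
    using f by (simp add: L2_disc_def)
qed

lemma L2_disc_zero: "(\<lambda>x. 0) \<in> L2_disc"
  by (rule L2_disc_bounded[where B = 0]) auto

lemma L2_disc_sum:
  assumes "\<And>k. k \<in> K \<Longrightarrow> g k \<in> L2_disc"
  shows "(\<lambda>x. \<Sum>k\<in>K. a k * g k x) \<in> L2_disc"
  using assms by (induction K rule: infinite_finite_induct) (auto intro!: L2_disc_zero L2_disc_add L2_disc_cmult)

lemma inner_disc_add_left:
  assumes "f \<in> L2_disc" "g \<in> L2_disc" "h \<in> L2_disc"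
  shows "inner_disc (\<lambda>x. f x + g x) h = inner_disc f h + inner_disc g h"
  unfolding inner_disc_def using L2_disc_integrable assms by (simp add: distrib_right)

lemma inner_disc_cmult_left: "inner_disc (\<lambda>x. c * f x) h = c * inner_disc f h"
  unfolding inner_disc_def by (simp add: mult.assoc)

lemma inner_disc_cnj: "cnj (inner_disc f g) = inner_disc g f"
  unfolding inner_disc_def
  by (subst Bochner_Integration.integral_cnj[symmetric]) (simp add: mult.commute)

lemma inner_disc_sum_left:
  assumes "\<And>k. k \<in> K \<Longrightarrow> g k \<in> L2_disc" "h \<in> L2_disc"
  shows "inner_disc (\<lambda>x. \<Sum>k\<in>K. a k * g k x) h = (\<Sum>k\<in>K. a k * inner_disc (g k) h)"
  using assms(1)
proof (induction K rule: infinite_finite_induct)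
  case (insert k K)
  then show ?case
    by (simp add: inner_disc_add_left inner_disc_cmult_left L2_disc_cmult L2_disc_sum assms(2))
qed (auto simp: inner_disc_def)

lemma inner_disc_sum_right:
  assumes "\<And>k. k \<in> K \<Longrightarrow> g k \<in> L2_disc" "h \<in> L2_disc"
  shows "inner_disc h (\<lambda>x. \<Sum>k\<in>K. a k * g k x) = (\<Sum>k\<in>K. cnj (a k) * inner_disc h (g k))"
  by (subst inner_disc_cnj[symmetric]) (simp add: inner_disc_sum_left assms inner_disc_cnj)

lemma norm_disc_nonneg: "norm_disc f \<ge> 0"
  by (simp add: norm_disc_def)

lemma norm_disc_sq: "(norm_disc f)\<^sup>2 = (\<integral>\<zeta>. (cmod (f \<zeta>))\<^sup>2 \<partial>disc_area)"
  unfolding norm_disc_def by (simp add: Bochner_Integration.integral_nonneg)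

lemma inner_disc_self: "inner_disc f f = of_real ((norm_disc f)\<^sup>2)"
  unfolding inner_disc_def norm_disc_sq
  by (simp add: complex_norm_square[symmetric] integral_complex_of_real[symmetric] del: integral_complex_of_real)

section \<open>Orthogonal families of norm at most one, and operators built from them\<close>

text \<open>Pythagoras: the cross terms vanish, and each diagonal term carries a factor
  \<open>(norm_disc (g k))\<^sup>2\<close> of at most 1.\<close>

lemma norm_disc_sum_orthogonal:
  assumes "finite K" and L2: "\<And>k. k \<in> K \<Longrightarrow> g k \<in> L2_disc"
    and orth: "\<And>j k. j \<in> K \<Longrightarrow> k \<in> K \<Longrightarrow> j \<noteq> k \<Longrightarrow> inner_disc (g j) (g k) = 0"
    and le: "\<And>k. k \<in> K \<Longrightarrow> norm_disc (g k) \<le> 1"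
  shows "(norm_disc (\<lambda>x. \<Sum>k\<in>K. a k * g k x))\<^sup>2 \<le> (\<Sum>k\<in>K. (cmod (a k))\<^sup>2)"
proof -
  let ?h = "\<lambda>x. \<Sum>k\<in>K. a k * g k x"
  have "inner_disc ?h ?h = (\<Sum>j\<in>K. a j * (\<Sum>k\<in>K. cnj (a k) * inner_disc (g j) (g k)))"
    by (subst inner_disc_sum_left) (auto simp: L2 L2_disc_sum inner_disc_sum_right)
  also have "\<dots> = (\<Sum>j\<in>K. a j * (\<Sum>k\<in>K. if k = j then cnj (a k) * inner_disc (g j) (g k) else 0))"
    using orth by (intro sum.cong arg_cong2[where f = "(*)"] refl) auto
  also have "\<dots> = of_real (\<Sum>j\<in>K. (cmod (a j))\<^sup>2 * (norm_disc (g j))\<^sup>2)"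
    using \<open>finite K\<close> by (simp add: inner_disc_self mult.assoc[symmetric] complex_norm_square[symmetric])
  finally have "(norm_disc ?h)\<^sup>2 = (\<Sum>j\<in>K. (cmod (a j))\<^sup>2 * (norm_disc (g j))\<^sup>2)"
    unfolding inner_disc_self of_real_eq_iff .
  also have "\<dots> \<le> (\<Sum>j\<in>K. (cmod (a j))\<^sup>2 * 1\<^sup>2)"
    by (intro sum_mono mult_left_mono power_mono le norm_disc_nonneg) auto
  finally show ?thesis
    by simp
qed

text \<open>Let \<open>h\<close> be the sum of the \<open>g k\<close> with the pairings as
  coefficients, and \<open>s\<close> the sum to be bounded. Expanding the squared norm of
  \<open>f - h\<close> gives the squared norm of \<open>f\<close>, minus \<open>2 * s\<close>, plus
  the squared norm of \<open>h\<close>; the latter is at most \<open>s\<close> by Pythagoras, even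
  if the \<open>g k\<close> are shorter than unit vectors.\<close>

lemma bessel_inequality_disc:
  assumes "finite K" and L2: "\<And>k. k \<in> K \<Longrightarrow> g k \<in> L2_disc"
    and orth: "\<And>j k. j \<in> K \<Longrightarrow> k \<in> K \<Longrightarrow> j \<noteq> k \<Longrightarrow> inner_disc (g j) (g k) = 0"
    and le: "\<And>k. k \<in> K \<Longrightarrow> norm_disc (g k) \<le> 1"
    and f: "f \<in> L2_disc"
  shows "(\<Sum>k\<in>K. (cmod (inner_disc f (g k)))\<^sup>2) \<le> (norm_disc f)\<^sup>2"
proof -
  define c where "c = (\<lambda>k. inner_disc f (g k))"
  have c: "inner_disc f (g k) = c k" for k
    by (simp add: c_def)
  define h where "h = (\<lambda>x. \<Sum>k\<in>K. c k * g k x)"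
  define s where "s = (\<Sum>k\<in>K. (cmod (c k))\<^sup>2)"
  have h: "h \<in> L2_disc"
    unfolding h_def by (rule L2_disc_sum) (rule L2)
  have mh: "(\<lambda>x. (-1) * h x) \<in> L2_disc"
    by (rule L2_disc_cmult) (rule h)
  have fh: "inner_disc f h = of_real s"
    unfolding h_def s_def by (simp add: inner_disc_sum_right L2 f c complex_norm_square mult.commute[of "cnj _"] del: of_real_power)
  let ?d = "\<lambda>x. f x + (-1) * h x"
  have d: "?d \<in> L2_disc"
    by (rule L2_disc_add) (rule f mh)+
  have hf: "inner_disc h f = of_real s"
    using arg_cong[OF fh, of cnj] by (simp add: inner_disc_cnj)
  have "inner_disc g' ?d = inner_disc g' f - inner_disc g' h" if g': "g' \<in> L2_disc" for g'
  proof -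
    have "inner_disc ?d g' = inner_disc f g' - inner_disc h g'"
      by (subst inner_disc_add_left[OF f mh g'], subst inner_disc_cmult_left) simp
    from arg_cong[OF this, of cnj] show ?thesis
      by (simp add: inner_disc_cnj)
  qed
  note right = this
  have "inner_disc ?d ?d = inner_disc f ?d + (-1) * inner_disc h ?d"
    by (subst inner_disc_add_left[OF f mh d], subst inner_disc_cmult_left) simp
  also have "\<dots> = of_real ((norm_disc f)\<^sup>2 - 2 * s + (norm_disc h)\<^sup>2)"
    by (simp only: right[OF f] right[OF h] fh hf inner_disc_self) simp
  finally have "(norm_disc ?d)\<^sup>2 = (norm_disc f)\<^sup>2 - 2 * s + (norm_disc h)\<^sup>2"
    unfolding inner_disc_self of_real_eq_iff .
  moreover have "(norm_disc h)\<^sup>2 \<le> s"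
    unfolding h_def s_def by (rule norm_disc_sum_orthogonal) (use assms in auto)
  moreover have "(norm_disc ?d)\<^sup>2 \<ge> 0"
    by simp
  ultimately show ?thesis
    unfolding s_def c_def by linarith
qed

text \<open>The partial sums converge only pointwise; boundedness of the limit is Fatou's lemma.\<close>

lemma bounded_operator_L2_orthogonal_series:
  assumes a: "\<And>k. \<alpha> k \<in> L2_disc" "\<And>j k. j \<noteq> k \<Longrightarrow> inner_disc (\<alpha> j) (\<alpha> k) = 0" "\<And>k. norm_disc (\<alpha> k) \<le> 1"
    and b: "\<And>k. \<beta> k \<in> L2_disc" "\<And>j k. j \<noteq> k \<Longrightarrow> inner_disc (\<beta> j) (\<beta> k) = 0" "\<And>k. norm_disc (\<beta> k) \<le> 1"
    and summ: "\<And>\<zeta>. cmod \<zeta> < 1 \<Longrightarrow> summable (\<lambda>k. cmod (\<beta> k \<zeta>))"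
  shows "bounded_operator_L2 (\<lambda>f \<zeta>. \<Sum>k. inner_disc f (\<alpha> k) * \<beta> k \<zeta>)" (is "bounded_operator_L2 ?T")
proof -
  \<comment> \<open>Bessel for a single vector is the Cauchy-Schwarz bound needed here.\<close>
  have bound: "cmod (inner_disc f (\<alpha> k)) \<le> norm_disc f" if f: "f \<in> L2_disc" for f k
    using bessel_inequality_disc[of "{k}" \<alpha> f] a f norm_disc_nonneg[of f]
    by (simp add: power2_le_iff_abs_le)
  have sm: "summable (\<lambda>k. inner_disc f (\<alpha> k) * \<beta> k \<zeta>)" if f: "f \<in> L2_disc" and z: "cmod \<zeta> < 1" for f \<zeta>
  proof (rule summable_norm_cancel, rule summable_comparison_test')
    show "summable (\<lambda>k. norm_disc f * cmod (\<beta> k \<zeta>))"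
      by (rule summable_mult) (rule summ[OF z])
    show "norm (norm (inner_disc f (\<alpha> k) * \<beta> k \<zeta>)) \<le> norm_disc f * cmod (\<beta> k \<zeta>)" for k
      by (simp add: norm_mult mult_right_mono bound[OF f])
  qed
  have main: "?T f \<in> L2_disc \<and> norm_disc (?T f) \<le> 1 * norm_disc f" if f: "f \<in> L2_disc" for f
  proof -
    define S where "S = (\<lambda>n \<zeta>. \<Sum>k<n. inner_disc f (\<alpha> k) * \<beta> k \<zeta>)"
    have lim: "(\<lambda>n. S n \<zeta>) \<longlonglongrightarrow> ?T f \<zeta>" if "cmod \<zeta> < 1" for \<zeta>
      unfolding S_def by (rule summable_LIMSEQ) (rule sm[OF f that])
    have SL2: "S n \<in> L2_disc" for n
      unfolding S_def by (rule L2_disc_sum) (rule b)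
    then have [measurable]: "S n \<in> borel_measurable disc_area" for n
      by (simp add: L2_disc_def)
    have [measurable]: "?T f \<in> borel_measurable disc_area"
      by (rule borel_measurable_LIMSEQ_metric[of S]) (auto intro: lim)
    \<comment> \<open>Pythagoras for the \<open>\<beta> k\<close> followed by Bessel for the
      \<open>\<alpha> k\<close> bounds all partial sums uniformly.\<close>
    have Sle: "(norm_disc (S n))\<^sup>2 \<le> (norm_disc f)\<^sup>2" for n
    proof -
      have "(norm_disc (S n))\<^sup>2 \<le> (\<Sum>k<n. (cmod (inner_disc f (\<alpha> k)))\<^sup>2)"
        unfolding S_def by (rule norm_disc_sum_orthogonal) (use b in auto)
      also have "\<dots> \<le> (norm_disc f)\<^sup>2"
        by (rule bessel_inequality_disc) (use a f in auto)
      finally show ?thesis .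
    qed
    have nn: "(\<integral>\<^sup>+\<zeta>. ennreal ((cmod (S n \<zeta>))\<^sup>2) \<partial>disc_area) \<le> ennreal ((norm_disc f)\<^sup>2)" for n
      using SL2[of n] Sle[of n]
      by (subst nn_integral_eq_integral) (auto simp: L2_disc_def norm_disc_sq[symmetric] intro!: ennreal_leI)
    have "(\<integral>\<^sup>+\<zeta>. ennreal ((cmod (?T f \<zeta>))\<^sup>2) \<partial>disc_area)
        = (\<integral>\<^sup>+\<zeta>. liminf (\<lambda>n. ennreal ((cmod (S n \<zeta>))\<^sup>2)) \<partial>disc_area)"
    proof (rule nn_integral_cong)
      fix \<zeta> assume "\<zeta> \<in> space disc_area"
      then have "(\<lambda>n. ennreal ((cmod (S n \<zeta>))\<^sup>2)) \<longlonglongrightarrow> ennreal ((cmod (?T f \<zeta>))\<^sup>2)"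
        by (intro tendsto_intros lim) auto
      then show "ennreal ((cmod (?T f \<zeta>))\<^sup>2) = liminf (\<lambda>n. ennreal ((cmod (S n \<zeta>))\<^sup>2))"
        by (intro lim_imp_Liminf[symmetric]) auto
    qed
    also have "\<dots> \<le> liminf (\<lambda>n. \<integral>\<^sup>+\<zeta>. ennreal ((cmod (S n \<zeta>))\<^sup>2) \<partial>disc_area)"
      by (rule nn_integral_liminf) measurable
    also have "\<dots> \<le> ennreal ((norm_disc f)\<^sup>2)"
    proof -
      have "liminf (\<lambda>n. \<integral>\<^sup>+\<zeta>. ennreal ((cmod (S n \<zeta>))\<^sup>2) \<partial>disc_area) \<le> liminf (\<lambda>n::nat. ennreal ((norm_disc f)\<^sup>2))"
        by (rule Liminf_mono) (intro always_eventually allI nn)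
      then show ?thesis
        by (simp add: Liminf_const)
    qed
    finally have fin: "(\<integral>\<^sup>+\<zeta>. ennreal ((cmod (?T f \<zeta>))\<^sup>2) \<partial>disc_area) \<le> ennreal ((norm_disc f)\<^sup>2)" .
    have int: "integrable disc_area (\<lambda>\<zeta>. (cmod (?T f \<zeta>))\<^sup>2)"
      by (rule integrableI_bounded) (use fin in \<open>auto intro: le_less_trans\<close>)
    have "ennreal ((norm_disc (?T f))\<^sup>2) \<le> ennreal ((norm_disc f)\<^sup>2)"
      using fin by (subst (asm) nn_integral_eq_integral[OF int]) (auto simp: norm_disc_sq)
    then have "norm_disc (?T f) \<le> norm_disc f"
      by (simp add: norm_disc_nonneg)
    then show ?thesis
      using int by (simp add: L2_disc_def)
  qed
  have add: "?T (\<lambda>x. f x + g x) \<zeta> = ?T f \<zeta> + ?T g \<zeta>" if "f \<in> L2_disc" "g \<in> L2_disc" "cmod \<zeta> < 1" for f g \<zeta>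
    using that by (simp add: inner_disc_add_left a distrib_right suminf_add sm)
  have mult: "?T (\<lambda>x. c * f x) \<zeta> = c * ?T f \<zeta>" if "f \<in> L2_disc" "cmod \<zeta> < 1" for c f \<zeta>
    using that by (simp add: inner_disc_cmult_left mult.assoc suminf_mult sm)
  show ?thesis
    unfolding bounded_operator_L2_def
  proof (intro conjI ballI allI exI[of _ "1::real"])
    show "?T f \<in> L2_disc" "norm_disc (?T f) \<le> 1 * norm_disc f" if "f \<in> L2_disc" for f
      using main[OF that] by auto
    show "AE \<zeta> in disc_area. ?T (\<lambda>x. f x + g x) \<zeta> = ?T f \<zeta> + ?T g \<zeta>" if "f \<in> L2_disc" "g \<in> L2_disc" for f g
      using add[OF that] by (intro AE_I2) auto
    show "AE \<zeta> in disc_area. ?T (\<lambda>x. c * f x) \<zeta> = c * ?T f \<zeta>" if "f \<in> L2_disc" for f c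
      using mult[OF that] by (intro AE_I2) auto
  qed
qed

text \<open>Termwise integration: the integrands are majorized by the constants
  \<open>H k * G\<close>, and the total mass is 1, so the integrals of their norms are summable
  too.\<close>

lemma inner_disc_suminf_left:
  assumes g: "g \<in> borel_measurable disc_area" "\<And>\<zeta>. cmod \<zeta> < 1 \<Longrightarrow> cmod (g \<zeta>) \<le> G"
    and h: "\<And>k. h k \<in> borel_measurable disc_area" "\<And>k \<zeta>. cmod \<zeta> < 1 \<Longrightarrow> cmod (h k \<zeta>) \<le> H k"
    and summ: "summable H"
  shows "(\<lambda>k. inner_disc (h k) g) sums inner_disc (\<lambda>\<zeta>. \<Sum>k. h k \<zeta>) g"
proof -
  note [measurable] = g(1) h(1)
  have G: "G \<ge> 0"
    using g(2)[of 0] norm_ge_zero[of "g 0"] by (simp del: norm_ge_zero)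
  have H: "H k \<ge> 0" for k
    using h(2)[of 0 k] norm_ge_zero[of "h k 0"] by (simp del: norm_ge_zero)
  have le: "cmod (h k \<zeta> * cnj (g \<zeta>)) \<le> H k * G" if "cmod \<zeta> < 1" for k \<zeta>
    using that by (auto simp: norm_mult intro!: mult_mono g h H)
  have int: "integrable disc_area (\<lambda>\<zeta>. h k \<zeta> * cnj (g \<zeta>))" for k
    by (rule integrable_disc_area_bounded[where B = "H k * G"]) (auto simp: le)
  have smh: "summable (\<lambda>k. h k \<zeta>)" if "cmod \<zeta> < 1" for \<zeta>
    by (rule summable_comparison_test'[OF summ]) (use h(2)[OF that] in auto)
  have "(\<lambda>k. integral\<^sup>L disc_area (\<lambda>\<zeta>. h k \<zeta> * cnj (g \<zeta>))) sums
      (\<integral>\<zeta>. (\<Sum>k. h k \<zeta> * cnj (g \<zeta>)) \<partial>disc_area)"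
  proof (rule sums_integral)
    show "AE \<zeta> in disc_area. summable (\<lambda>k. norm (h k \<zeta> * cnj (g \<zeta>)))"
      by (intro AE_I2 summable_comparison_test'[OF summable_mult2[OF summ, of G]]) (use le in auto)
    show "summable (\<lambda>k. \<integral>\<zeta>. norm (h k \<zeta> * cnj (g \<zeta>)) \<partial>disc_area)"
    proof (rule summable_comparison_test'[OF summable_mult2[OF summ, of G]])
      fix k
      have "(\<integral>\<zeta>. norm (h k \<zeta> * cnj (g \<zeta>)) \<partial>disc_area) \<le> (\<integral>\<zeta>. H k * G \<partial>disc_area)"
        by (rule integral_mono) (use int le in \<open>auto intro: integrable_disc_area_bounded simp del: norm_mult\<close>)
      also have "\<dots> = H k * G"
        by (simp add: measure_def emeasure_disc_area_space)
      finally show "norm (\<integral>\<zeta>. norm (h k \<zeta> * cnj (g \<zeta>)) \<partial>disc_area) \<le> H k * G"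
        by (simp add: Bochner_Integration.integral_nonneg)
    qed
  qed (rule int)
  also have "(\<integral>\<zeta>. (\<Sum>k. h k \<zeta> * cnj (g \<zeta>)) \<partial>disc_area) = (\<integral>\<zeta>. (\<Sum>k. h k \<zeta>) * cnj (g \<zeta>) \<partial>disc_area)"
    by (rule Bochner_Integration.integral_cong) (auto simp: suminf_mult2 smh)
  finally show ?thesis
    unfolding inner_disc_def .
qed

section \<open>Pairing polynomials with Szego kernels\<close>

lemma norm_cnj_mult_less_1: "cmod z < 1 \<Longrightarrow> cmod \<zeta> < 1 \<Longrightarrow> cmod (cnj z * \<zeta>) < 1"
  using mult_strict_mono[of "cmod z" 1 "cmod \<zeta>" 1]
  by (cases "z = 0") (auto simp: norm_mult)

lemma szego_bounded:
  assumes "cmod z < 1" "cmod \<zeta> < 1"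
  shows "cmod (szego z \<zeta>) \<le> 1 / (1 - cmod z)"
proof -
  have "cmod (cnj z * \<zeta>) \<le> cmod z * 1"
    unfolding norm_mult complex_mod_cnj using assms by (intro mult_left_mono) auto
  then have "1 - cmod z \<le> cmod (1 - cnj z * \<zeta>)"
    using norm_triangle_ineq2[of 1 "cnj z * \<zeta>"] by simp
  then show ?thesis
    using assms by (auto simp: szego_def norm_divide intro!: frac_le)
qed

lemma szego_measurable:
  assumes "cmod z < 1"
  shows "szego z \<in> borel_measurable disc_area"
proof (rule continuous_on_borel_measurable_disc_area)
  have "1 - cnj z * \<zeta> \<noteq> 0" if "cmod \<zeta> < 1" for \<zeta>
    using norm_cnj_mult_less_1[OF assms that] by auto
  then show "continuous_on (ball 0 1) (szego z)"
    unfolding szego_def by (intro continuous_intros) auto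
qed

lemma szego_L2_disc: "cmod z < 1 \<Longrightarrow> szego z \<in> L2_disc"
  by (rule L2_disc_bounded[OF szego_measurable szego_bounded])

lemma monomial_L2_disc: "(\<lambda>\<zeta>. \<zeta> ^ n) \<in> L2_disc"
  by (rule L2_disc_bounded[where B = 1]) (auto simp: norm_power power_le_one)

lemma inner_disc_monomials:
  "inner_disc (\<lambda>\<zeta>. \<zeta> ^ n) (\<lambda>\<zeta>. \<zeta> ^ m) = (if n = m then 1 / (of_nat n + 1) else 0)"
  using integral_disc_area_monomials[of n m] by (simp add: inner_disc_def)

text \<open>Expand the kernel as a geometric series and integrate termwise; only the exponent
  \<open>n\<close> survives. The Szego kernel reproduces in the Hardy space, so in the area pairing
  the factor \<open>1 / (n + 1)\<close> remains.\<close>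

lemma inner_disc_monomial_szego:
  assumes z: "cmod z < 1"
  shows "inner_disc (\<lambda>\<zeta>. \<zeta> ^ n) (szego z) = z ^ n / (of_nat n + 1)"
proof -
  have "(\<lambda>k. inner_disc (\<lambda>\<zeta>. cnj z ^ k * \<zeta> ^ k) (\<lambda>\<zeta>. \<zeta> ^ n)) sums
      inner_disc (\<lambda>\<zeta>. \<Sum>k. cnj z ^ k * \<zeta> ^ k) (\<lambda>\<zeta>. \<zeta> ^ n)"
  proof (rule inner_disc_suminf_left[where G = 1 and H = "\<lambda>k. cmod z ^ k"])
    show "summable (\<lambda>k. cmod z ^ k)"
      using z by simp
    show "cmod (cnj z ^ k * \<zeta> ^ k) \<le> cmod z ^ k" if "cmod \<zeta> < 1" for k \<zeta>
      using that by (simp add: norm_mult norm_power mult_left_le power_le_one)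
  qed (auto simp: norm_power power_le_one)
  also have "(\<lambda>k. inner_disc (\<lambda>\<zeta>. cnj z ^ k * \<zeta> ^ k) (\<lambda>\<zeta>. \<zeta> ^ n))
      = (\<lambda>k. if k = n then cnj z ^ k / (of_nat k + 1) else 0)"
    by (auto simp: inner_disc_cmult_left inner_disc_monomials)
  finally have "inner_disc (\<lambda>\<zeta>. \<Sum>k. cnj z ^ k * \<zeta> ^ k) (\<lambda>\<zeta>. \<zeta> ^ n) = cnj z ^ n / (of_nat n + 1)"
    using sums_single[of n "\<lambda>n. cnj z ^ n / (of_nat n + 1)"] by (rule sums_unique2)
  moreover have "inner_disc (\<lambda>\<zeta>. \<Sum>k. cnj z ^ k * \<zeta> ^ k) (\<lambda>\<zeta>. \<zeta> ^ n) = inner_disc (szego z) (\<lambda>\<zeta>. \<zeta> ^ n)"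
    unfolding inner_disc_def
  proof (rule Bochner_Integration.integral_cong)
    fix \<zeta> assume "\<zeta> \<in> space disc_area"
    then have "(\<Sum>k. cnj z ^ k * \<zeta> ^ k) = szego z \<zeta>"
      unfolding power_mult_distrib[symmetric] szego_def
      by (intro suminf_geometric norm_cnj_mult_less_1 z) auto
    then show "(\<Sum>k. cnj z ^ k * \<zeta> ^ k) * cnj (\<zeta> ^ n) = szego z \<zeta> * cnj (\<zeta> ^ n)"
      by simp
  qed simp
  ultimately have "inner_disc (szego z) (\<lambda>\<zeta>. \<zeta> ^ n) = cnj z ^ n / (of_nat n + 1)"
    by simp
  from arg_cong[OF this, of cnj] show ?thesis
    by (simp add: inner_disc_cnj)
qed

section \<open>Block polynomials and their harmonic sums\<close>

definition block_poly :: "nat set \<Rightarrow> complex \<Rightarrow> complex" where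
  "block_poly E \<zeta> = (\<Sum>n\<in>E. \<zeta> ^ n)"

text \<open>Two roles for finite \<open>E\<close>: for \<open>\<bar>x\<bar> < 1\<close> it is the
  pairing of \<open>block_poly E\<close> with the kernel at \<open>x\<close>, and at
  \<open>x = 1\<close> it is the squared norm of \<open>block_poly E\<close>.\<close>

definition block_sum :: "nat set \<Rightarrow> real \<Rightarrow> real" where
  "block_sum E x = (\<Sum>n\<in>E. x ^ n / (real n + 1))"

lemma block_poly_L2_disc: "block_poly E \<in> L2_disc"
  using L2_disc_sum[of E "\<lambda>n \<zeta>. \<zeta> ^ n" "\<lambda>_. 1"] monomial_L2_disc
  by (simp add: block_poly_def[abs_def])

lemma inner_disc_block_poly_left:
  "g \<in> L2_disc \<Longrightarrow> inner_disc (block_poly E) g = (\<Sum>n\<in>E. inner_disc (\<lambda>\<zeta>. \<zeta> ^ n) g)"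
  using inner_disc_sum_left[of E "\<lambda>n \<zeta>. \<zeta> ^ n" g "\<lambda>_. 1"] monomial_L2_disc
  by (simp add: block_poly_def[abs_def])

lemma inner_disc_block_poly_right:
  "g \<in> L2_disc \<Longrightarrow> inner_disc g (block_poly E) = (\<Sum>n\<in>E. inner_disc g (\<lambda>\<zeta>. \<zeta> ^ n))"
  using inner_disc_sum_right[of E "\<lambda>n \<zeta>. \<zeta> ^ n" g "\<lambda>_. 1"] monomial_L2_disc
  by (simp add: block_poly_def[abs_def])

lemma inner_disc_block_poly:
  assumes "finite E" "finite F"
  shows "inner_disc (block_poly E) (block_poly F) = of_real (block_sum (E \<inter> F) 1)"
proof -
  have "inner_disc (block_poly E) (block_poly F)
      = (\<Sum>n\<in>E. \<Sum>m\<in>F. if m = n then 1 / (of_nat n + 1) else 0)"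
    unfolding inner_disc_block_poly_left[OF block_poly_L2_disc]
      inner_disc_block_poly_right[OF monomial_L2_disc] inner_disc_monomials
    by (auto intro!: sum.cong)
  also have "\<dots> = of_real (block_sum (E \<inter> F) 1)"
    using assms by (simp add: block_sum_def sum.inter_restrict if_distrib[of complex_of_real] cong: if_cong)
  finally show ?thesis .
qed

lemma inner_disc_cnj_block_poly:
  assumes "finite E" "finite F"
  shows "inner_disc (\<lambda>\<zeta>. cnj (block_poly E \<zeta>)) (\<lambda>\<zeta>. cnj (block_poly F \<zeta>)) = of_real (block_sum (E \<inter> F) 1)"
  using inner_disc_block_poly[OF assms(2,1)] by (simp add: inner_disc_def mult.commute Int_commute)

lemma norm_disc_block_poly:
  assumes "finite E"
  shows "(norm_disc (block_poly E))\<^sup>2 = block_sum E 1"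
  using inner_disc_block_poly[OF assms assms] unfolding inner_disc_self of_real_eq_iff by simp

lemma inner_disc_block_poly_szego:
  assumes x: "\<bar>x\<bar> < 1"
  shows "inner_disc (block_poly E) (szego (of_real x)) = of_real (block_sum E x)"
  using x by (simp add: inner_disc_block_poly_left szego_L2_disc inner_disc_monomial_szego block_sum_def)

text \<open>The symbol feeds conjugated kernels into the operator. Conjugating both entries swaps
  them, so conjugated polynomials give the same real value as before.\<close>

lemma inner_disc_cnj_szego_block_poly:
  assumes x: "\<bar>x\<bar> < 1"
  shows "inner_disc (\<lambda>\<zeta>. cnj (szego (of_real x) \<zeta>)) (\<lambda>\<zeta>. cnj (block_poly E \<zeta>)) = of_real (block_sum E x)"
  using inner_disc_block_poly_szego[OF x, of E] by (simp add: inner_disc_def mult.commute)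

lemma cmod_block_poly_le: "cmod (block_poly E \<zeta>) \<le> (\<Sum>n\<in>E. cmod \<zeta> ^ n)"
  unfolding block_poly_def by (rule order_trans[OF norm_sum]) (simp add: norm_power)

lemma block_sum_nonneg: "0 \<le> x \<Longrightarrow> 0 \<le> block_sum E x"
  unfolding block_sum_def by (intro sum_nonneg) auto

lemma block_sum_mono: "0 \<le> x \<Longrightarrow> x \<le> y \<Longrightarrow> block_sum E x \<le> block_sum E y"
  unfolding block_sum_def by (intro sum_mono divide_right_mono power_mono) auto

text \<open>Powers decrease in the exponent, so the smallest one can be factored out. Near
  \<open>x = 1\<close> the harmonic sum of a block is thus nearly retained.\<close>

lemma block_sum_ge:
  assumes x: "0 \<le> x" "x \<le> 1" and E: "\<And>n. n \<in> E \<Longrightarrow> n \<le> b"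
  shows "x ^ b * block_sum E 1 \<le> block_sum E x"
  unfolding block_sum_def sum_distrib_left
  using assms by (intro sum_mono) (auto intro!: divide_right_mono power_decreasing)

text \<open>There are at most \<open>d \<le> a + 1\<close> terms, each at most
  \<open>x ^ a / (a + 1)\<close>. At \<open>x = 1\<close> this bounds a norm; for
  \<open>x < 1\<close> it gives the decay behind convergence of the symbol.\<close>

lemma block_sum_le:
  assumes x: "0 \<le> x" "x \<le> 1" and E: "E \<subseteq> {a..<a + d}" and d: "d \<le> a + 1"
  shows "block_sum E x \<le> x ^ a"
proof -
  have "block_sum E x \<le> (\<Sum>n\<in>E. x ^ a / (real a + 1))"
    unfolding block_sum_def using x E by (intro sum_mono frac_le power_decreasing) auto
  also have "\<dots> = real (card E) * (x ^ a / (real a + 1))"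
    by simp
  also have "\<dots> \<le> (real a + 1) * (x ^ a / (real a + 1))"
  proof (intro mult_right_mono)
    have "card E \<le> d"
      using card_mono[OF _ E] by simp
    then show "real (card E) \<le> real a + 1"
      using d by linarith
  qed (use x in auto)
  finally show ?thesis
    by simp
qed

text \<open>Each dyadic interval from \<open>N\<close> to \<open>2 * N\<close> has \<open>N\<close>
  terms of size at least \<open>1 / (2 * N)\<close>, hence contributes at least one half.\<close>

lemma block_sum_dyadic_ge: "block_sum {2 ^ a..<2 ^ (a + d)} 1 \<ge> real d / 2"
proof (induction d)
  case (Suc d)
  let ?N = "2 ^ (a + d) :: nat"
  have "(\<Sum>n = ?N..<2 * ?N. 1 / (2 * real ?N)) \<le> block_sum {?N..<2 * ?N} 1"
    unfolding block_sum_def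
  proof (intro sum_mono)
    fix n assume "n \<in> {?N..<2 * ?N}"
    then have "n + 1 \<le> 2 * ?N"
      by simp
    then have "real n + 1 \<le> 2 * real ?N"
      using of_nat_mono[of "n + 1" "2 * ?N", where 'a = real] by simp
    then show "1 / (2 * real ?N) \<le> 1 ^ n / (real n + 1)"
      by (auto intro!: divide_left_mono)
  qed
  then have "1 / 2 \<le> block_sum {?N..<2 * ?N} 1"
    by simp
  moreover have "block_sum {2 ^ a..<2 ^ (a + Suc d)} 1 = block_sum {2 ^ a..<?N} 1 + block_sum {?N..<2 * ?N} 1"
    unfolding block_sum_def by (subst sum.atLeastLessThan_concat) auto
  ultimately show ?case
    using Suc.IH by (simp add: field_simps)
qed (simp add: block_sum_def)

lemma has_field_derivative_block_sum:
  "(block_sum E has_real_derivative (\<Sum>n\<in>E. real n * x ^ (n - 1) / (real n + 1))) (at x)"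
  unfolding block_sum_def[abs_def] by (auto intro!: derivative_eq_intros sum.cong)

text \<open>Differentiation cancels the harmonic weights: since \<open>n \<ge> 1\<close>,
  \<open>n / (n + 1)\<close> is at least one half, and there are \<open>a\<close> terms.\<close>

lemma deriv_block_sum_ge:
  assumes x: "0 \<le> x" "x \<le> 1" and "0 < a"
  shows "(\<Sum>n\<in>{a..<2 * a}. real n * x ^ (n - 1) / (real n + 1)) \<ge> real a * x ^ (2 * a) / 2"
proof -
  have "(\<Sum>n\<in>{a..<2 * a}. x ^ (2 * a) / 2) \<le> (\<Sum>n\<in>{a..<2 * a}. real n * x ^ (n - 1) / (real n + 1))"
  proof (intro sum_mono)
    fix n assume n: "n \<in> {a..<2 * a}"
    have "x ^ (2 * a) * (1 / 2) \<le> x ^ (n - 1) * (real n / (real n + 1))"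
      using n x \<open>0 < a\<close> by (intro mult_mono power_decreasing) (auto simp: field_simps)
    then show "x ^ (2 * a) / 2 \<le> real n * x ^ (n - 1) / (real n + 1)"
      by (simp add: mult.commute)
  qed
  then show ?thesis
    by simp
qed

section \<open>The block operator\<close>

text \<open>
  The short block \<open>{mid k..<2 * mid k}\<close> makes differentiation cost a full factor \<open>mid k\<close>; the long block
  spans \<open>2 * k + 1\<close> dyadic intervals, so its harmonic sum \<open>weight k\<close> tends to infinity with \<open>k\<close>.
\<close>

definition mid :: "nat \<Rightarrow> nat" where
  "mid k = 2 ^ (k * k + 2 * k)"

definition short_block :: "nat \<Rightarrow> nat set" where
  "short_block k = {mid k..<2 * mid k}"

definition long_block :: "nat \<Rightarrow> nat set" where
  "long_block k = {2 ^ (k * k)..<2 * mid k}"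

definition weight :: "nat \<Rightarrow> real" where
  "weight k = block_sum (long_block k) 1"

text \<open>Conjugated to match the conjugated kernels in the symbol.\<close>

definition test_in :: "nat \<Rightarrow> complex \<Rightarrow> complex" where
  "test_in k \<zeta> = cnj (block_poly (short_block k) \<zeta>)"

text \<open>The factor normalizes to a unit vector, as \<open>weight k\<close> is the squared norm
  of the long block polynomial.\<close>

definition test_out :: "nat \<Rightarrow> complex \<Rightarrow> complex" where
  "test_out k \<zeta> = of_real (1 / sqrt (weight k)) * block_poly (long_block k) \<zeta>"

text \<open>The diagonal symbol at real \<open>x\<close> of the rank one operator built from
  \<open>test_in k\<close> and \<open>test_out k\<close>.\<close>

definition block_term :: "nat \<Rightarrow> real \<Rightarrow> real" where
  "block_term k x = block_sum (short_block k) x * block_sum (long_block k) x / sqrt (weight k)"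

definition block_operator :: "(complex \<Rightarrow> complex) \<Rightarrow> complex \<Rightarrow> complex" where
  "block_operator f \<zeta> = (\<Sum>k. inner_disc f (test_in k) * test_out k \<zeta>)"

section \<open>Disjoint blocks, normalization and boundedness\<close>

lemma finite_blocks [simp]: "finite (short_block k)" "finite (long_block k)"
  by (simp_all add: short_block_def long_block_def)

lemma mid_pos: "0 < mid k"
  by (simp add: mid_def)

text \<open>Since \<open>k * k + 2 * k + 1\<close> is the next square, each long block ends exactly
  where the following one begins.\<close>

lemma two_mid: "2 * mid k = 2 ^ (Suc k * Suc k)"
  by (simp add: mid_def flip: power_Suc)

lemma two_mid_le: "j < k \<Longrightarrow> 2 * mid j \<le> 2 ^ (k * k)"
  unfolding two_mid by (intro power_increasing mult_mono) auto

lemma long_block_disjoint: "j \<noteq> k \<Longrightarrow> long_block j \<inter> long_block k = {}"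
proof (induction j k rule: linorder_wlog)
  case (le j k)
  then show ?case
    using two_mid_le[of j k] by (auto simp: long_block_def)
qed auto

lemma short_block_subset: "short_block k \<subseteq> long_block k"
  unfolding short_block_def long_block_def mid_def
  by (intro ivl_subset[THEN iffD2] disjI2 conjI power_increasing) auto

lemma weight_ge: "weight k \<ge> real k + 1 / 2"
proof -
  have "long_block k = {2 ^ (k * k)..<2 ^ (k * k + (2 * k + 1))}"
    by (simp add: long_block_def mid_def flip: power_Suc)
  then show ?thesis
    unfolding weight_def using block_sum_dyadic_ge[of "2 * k + 1" "k * k"] by (simp add: field_simps)
qed

lemma weight_pos: "0 < weight k"
  using weight_ge[of k] by linarith

lemma inverse_sqrt_weight_le: "1 / sqrt (weight k) \<le> 2"
proof -
  \<comment> \<open>The weight is at least one half, already at \<open>k = 0\<close>; the smaller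
    value \<open>1 / 4\<close> has a rational root.\<close>
  have "sqrt (1 / 4) \<le> sqrt (weight k)"
    using weight_ge[of k] by (intro real_sqrt_le_mono) linarith
  then have "1 / 2 \<le> sqrt (weight k)"
    by (simp add: real_sqrt_divide)
  then show ?thesis
    using weight_pos[of k] by (simp add: field_simps)
qed

lemma test_in_L2_disc: "test_in k \<in> L2_disc"
  using block_poly_L2_disc[of "short_block k"]
  by (auto simp: test_in_def[abs_def] L2_disc_def)

lemma test_out_L2_disc: "test_out k \<in> L2_disc"
  unfolding test_out_def[abs_def] by (intro L2_disc_cmult block_poly_L2_disc)

lemma inner_disc_test_in:
  assumes "j \<noteq> k"
  shows "inner_disc (test_in j) (test_in k) = 0"
proof -
  have "short_block j \<inter> short_block k = {}"
    using long_block_disjoint[OF assms] short_block_subset by blast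
  then show ?thesis
    by (simp add: test_in_def[abs_def] inner_disc_cnj_block_poly block_sum_def)
qed

lemma inner_disc_test_out:
  assumes "j \<noteq> k"
  shows "inner_disc (test_out j) (test_out k) = 0"
proof -
  have "inner_disc (block_poly (long_block j)) (test_out k)
      = cnj (inner_disc (test_out k) (block_poly (long_block j)))"
    by (simp add: inner_disc_cnj)
  also have "\<dots> = 0"
    unfolding test_out_def[abs_def] inner_disc_cmult_left
    using long_block_disjoint[of k j] assms by (simp add: inner_disc_block_poly block_sum_def)
  finally show ?thesis
    by (subst test_out_def[abs_def]) (simp only: inner_disc_cmult_left mult_zero_right)
qed

lemma norm_disc_test_in: "norm_disc (test_in k) \<le> 1"
proof -
  have "(norm_disc (test_in k))\<^sup>2 = block_sum (short_block k) 1"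
    using norm_disc_block_poly[of "short_block k"] by (simp add: test_in_def norm_disc_sq)
  also have "\<dots> \<le> 1 ^ mid k"
    by (rule block_sum_le[of _ _ _ "mid k"]) (auto simp: short_block_def)
  finally show ?thesis
    by (simp add: power2_le_imp_le[of _ 1])
qed

lemma norm_disc_test_out: "norm_disc (test_out k) \<le> 1"
proof -
  have "(norm_disc (test_out k))\<^sup>2 = (1 / sqrt (weight k))\<^sup>2 * (norm_disc (block_poly (long_block k)))\<^sup>2"
    by (simp add: norm_disc_sq test_out_def norm_mult norm_divide power_mult_distrib power_divide)
  also have "\<dots> = 1"
    using weight_pos[of k] by (simp add: norm_disc_block_poly weight_def power_divide)
  finally show ?thesis
    using norm_disc_nonneg[of "test_out k"] by (simp add: power2_eq_1_iff)
qed

lemma cmod_test_out_le: "cmod (test_out k \<zeta>) \<le> 2 * (\<Sum>n\<in>long_block k. cmod \<zeta> ^ n)"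
proof -
  have "cmod (test_out k \<zeta>) = 1 / sqrt (weight k) * cmod (block_poly (long_block k) \<zeta>)"
    using weight_pos[of k] by (simp add: test_out_def norm_mult norm_divide)
  also have "\<dots> \<le> 2 * (\<Sum>n\<in>long_block k. cmod \<zeta> ^ n)"
    by (intro mult_mono inverse_sqrt_weight_le cmod_block_poly_le) auto
  finally show ?thesis .
qed

text \<open>A crude bound uniform in \<open>\<zeta>\<close>: fewer than \<open>2 * mid k\<close>
  monomials of modulus at most 1, and a normalizing factor of at most 2.\<close>

lemma cmod_test_out_le_mid:
  assumes "cmod \<zeta> < 1"
  shows "cmod (test_out k \<zeta>) \<le> 4 * real (mid k)"
proof -
  have "(\<Sum>n\<in>long_block k. cmod \<zeta> ^ n) \<le> (\<Sum>n\<in>long_block k. 1)"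
    using assms by (intro sum_mono) (simp add: power_le_one)
  also have "\<dots> \<le> real (2 * mid k)"
    unfolding long_block_def by (subst sum_constant) (simp add: of_nat_diff_if)
  finally show ?thesis
    using cmod_test_out_le[of k \<zeta>] by simp
qed

text \<open>As the blocks are disjoint, the partial sums are sums of distinct terms of one geometric
  series.\<close>

lemma summable_test_out:
  assumes "cmod \<zeta> < 1"
  shows "summable (\<lambda>k. cmod (test_out k \<zeta>))"
proof (rule summable_comparison_test')
  have "summable (\<lambda>k. \<Sum>n\<in>long_block k. cmod \<zeta> ^ n)"
  proof (rule bounded_imp_summable)
    fix K
    have "(\<Sum>k\<le>K. \<Sum>n\<in>long_block k. cmod \<zeta> ^ n) = (\<Sum>n\<in>(\<Union>k\<le>K. long_block k). cmod \<zeta> ^ n)"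
      by (rule sum.UNION_disjoint[symmetric]) (auto simp: long_block_disjoint)
    also have "\<dots> \<le> (\<Sum>n. cmod \<zeta> ^ n)"
      using assms by (intro sum_le_suminf) auto
    finally show "(\<Sum>k\<le>K. \<Sum>n\<in>long_block k. cmod \<zeta> ^ n) \<le> (\<Sum>n. cmod \<zeta> ^ n)" .
  qed (auto intro: sum_nonneg)
  then show "summable (\<lambda>k. 2 * (\<Sum>n\<in>long_block k. cmod \<zeta> ^ n))"
    by (rule summable_mult)
  show "norm (cmod (test_out k \<zeta>)) \<le> 2 * (\<Sum>n\<in>long_block k. cmod \<zeta> ^ n)" for k
    using cmod_test_out_le by simp
qed

lemma bounded_operator_block_operator: "bounded_operator_L2 block_operator"
  unfolding block_operator_def[abs_def]
  by (rule bounded_operator_L2_orthogonal_series)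
    (simp_all add: test_in_L2_disc inner_disc_test_in norm_disc_test_in
      test_out_L2_disc inner_disc_test_out norm_disc_test_out summable_test_out)

section \<open>The symbol on the positive real axis\<close>

text \<open>Up to the factor 4 this is the subseries of \<open>n * x ^ n\<close> along the injective
  sequence \<open>mid\<close>.\<close>

lemma summable_mid_power:
  assumes x: "0 \<le> x" "x < 1"
  shows "summable (\<lambda>k. x ^ mid k * (4 * real (mid k)))"
proof -
  have "summable (\<lambda>n. of_nat (Suc n) * x ^ n)"
    using geometric_deriv_sums[of x] x by (auto simp: sums_iff)
  then have "summable (\<lambda>n. real n * x ^ n)"
    by (rule summable_comparison_test') (use x in \<open>auto intro!: mult_right_mono\<close>)
  then have "summable ((\<lambda>n. real n * x ^ n) \<circ> mid)"
  proof (rule summable_reindex)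
    have "strict_mono mid"
      unfolding mid_def by (intro strict_monoI_Suc power_strict_increasing) auto
    then show "inj mid"
      by (rule strict_mono_imp_inj_on)
  qed (use x in auto)
  from summable_mult[OF this, of 4] show ?thesis
    by (simp add: o_def mult_ac)
qed

text \<open>Interchanging the series with the pairing needs a majorant independent of
  \<open>\<zeta>\<close>: the input coefficients decay like \<open>x ^ mid k\<close>, which beats
  the growth \<open>4 * mid k\<close> of the outputs.\<close>

lemma dirichlet_symbol_block_operator:
  assumes x: "0 \<le> x" "x < 1"
  shows "(\<lambda>k. complex_of_real (block_term k x)) sums dirichlet_symbol block_operator (of_real x) (of_real x)"
proof -
  let ?s = "szego (of_real x)"
  let ?c = "\<lambda>k. inner_disc (\<lambda>\<zeta>. cnj (?s \<zeta>)) (test_in k)"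
  have c: "?c k = of_real (block_sum (short_block k) x)" for k
    unfolding test_in_def[abs_def] using x by (intro inner_disc_cnj_szego_block_poly) auto
  have "(\<lambda>k. inner_disc (\<lambda>\<zeta>. ?c k * test_out k \<zeta>) ?s) sums inner_disc (\<lambda>\<zeta>. \<Sum>k. ?c k * test_out k \<zeta>) ?s"
  proof (rule inner_disc_suminf_left)
    show "?s \<in> borel_measurable disc_area"
      using x by (intro szego_measurable) auto
    show "cmod (?s \<zeta>) \<le> 1 / (1 - cmod (of_real x))" if "cmod \<zeta> < 1" for \<zeta>
      using x that by (intro szego_bounded) auto
    show "(\<lambda>\<zeta>. ?c k * test_out k \<zeta>) \<in> borel_measurable disc_area" for k
      using L2_disc_cmult[OF test_out_L2_disc] by (simp add: L2_disc_def)
    show "cmod (?c k * test_out k \<zeta>) \<le> x ^ mid k * (4 * real (mid k))" if "cmod \<zeta> < 1" for k \<zeta>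
    proof -
      have "block_sum (short_block k) x \<le> x ^ mid k"
        using x by (intro block_sum_le[of _ _ _ "mid k"]) (auto simp: short_block_def)
      then show ?thesis
        using x cmod_test_out_le_mid[OF that, of k] block_sum_nonneg[OF x(1), of "short_block k"]
        unfolding c norm_mult norm_of_real by (intro mult_mono) auto
    qed
    show "summable (\<lambda>k. x ^ mid k * (4 * real (mid k)))"
      using x by (rule summable_mid_power)
  qed
  also have "(\<lambda>k. inner_disc (\<lambda>\<zeta>. ?c k * test_out k \<zeta>) ?s) = (\<lambda>k. complex_of_real (block_term k x))"
    using x
    unfolding test_out_def[abs_def] inner_disc_cmult_left c
    by (simp add: inner_disc_block_poly_szego block_term_def)
  also have "inner_disc (\<lambda>\<zeta>. \<Sum>k. ?c k * test_out k \<zeta>) ?s = dirichlet_symbol block_operator (of_real x) (of_real x)"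
    by (simp add: dirichlet_symbol_def block_operator_def[abs_def])
  finally show ?thesis .
qed

section \<open>Growth of the derivative and failure of the Bloch condition\<close>

lemma block_term_mono:
  assumes "0 \<le> x" "x \<le> y"
  shows "block_term k x \<le> block_term k y"
  unfolding block_term_def
proof (intro divide_right_mono mult_mono)
  show "0 \<le> sqrt (weight k)"
    using weight_pos[of k] by simp
qed (use assms in \<open>simp_all add: block_sum_mono block_sum_nonneg\<close>)

text \<open>All other summands of the series are nondecreasing, so one summand controls the derivative.\<close>

lemma mono_on_symbol_minus_block_term:
  "mono_on {0..<1} (\<lambda>x. Re (dirichlet_symbol block_operator (of_real x) (of_real x)) - block_term k x)"
proof (rule mono_onI)
  fix x y :: real
  assume xy: "x \<in> {0..<1}" "y \<in> {0..<1}" "x \<le> y"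
  let ?f = "\<lambda>x. Re (dirichlet_symbol block_operator (of_real x) (of_real x))"
  have f: "(\<lambda>j. block_term j x) sums ?f x" if "x \<in> {0..<1}" for x
    using sums_Re[OF dirichlet_symbol_block_operator[of x]] that by simp
  have sums: "(\<lambda>j. block_term j y - block_term j x) sums (?f y - ?f x)"
    by (intro sums_diff f xy)
  \<comment> \<open>All increments are nonnegative, so a single one is at most their total.\<close>
  then have "(\<Sum>j\<in>{k}. block_term j y - block_term j x) \<le> (\<Sum>j. block_term j y - block_term j x)"
    using xy by (intro sum_le_suminf) (auto simp: sums_iff intro: block_term_mono)
  also have "\<dots> = ?f y - ?f x"
    using sums by (rule sums_unique[symmetric])
  finally show "?f x - block_term k x \<le> ?f y - block_term k y"
    by simp
qed

text \<open>In the product rule the term differentiating the long factor is nonnegative and is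
  dropped. Differentiating the short factor gives \<open>mid k / 2\<close>, the long factor gives
  \<open>weight k\<close>, each up to a power of \<open>x\<close>; normalization leaves
  \<open>sqrt (weight k)\<close>.\<close>

lemma block_term_derivative:
  assumes x: "0 \<le> x" "x \<le> 1"
  obtains D where "(block_term k has_real_derivative D) (at x)"
    and "real (mid k) * x ^ (2 * mid k) * x ^ (2 * mid k) * sqrt (weight k) / 2 \<le> D"
proof -
  let ?A = "block_sum (short_block k)" and ?B = "block_sum (long_block k)"
  define A' where "A' = (\<Sum>n\<in>short_block k. real n * x ^ (n - 1) / (real n + 1))"
  define B' where "B' = (\<Sum>n\<in>long_block k. real n * x ^ (n - 1) / (real n + 1))"
  have "(block_term k has_real_derivative (A' * ?B x + B' * ?A x) / sqrt (weight k)) (at x)"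
    unfolding block_term_def[abs_def] A'_def B'_def
    by (intro DERIV_cdivide DERIV_mult has_field_derivative_block_sum)
  moreover have "real (mid k) * x ^ (2 * mid k) * x ^ (2 * mid k) * sqrt (weight k) / 2
      \<le> (A' * ?B x + B' * ?A x) / sqrt (weight k)"
  proof -
    have A': "real (mid k) * x ^ (2 * mid k) / 2 \<le> A'"
      unfolding A'_def short_block_def using x mid_pos by (intro deriv_block_sum_ge)
    have "0 \<le> A'"
      unfolding A'_def using x by (intro sum_nonneg) auto
    have B: "x ^ (2 * mid k) * weight k \<le> ?B x"
      unfolding weight_def using x by (intro block_sum_ge) (auto simp: long_block_def)
    have "B' * ?A x \<ge> 0"
      unfolding B'_def using x by (intro mult_nonneg_nonneg sum_nonneg block_sum_nonneg) auto
    moreover have "(real (mid k) * x ^ (2 * mid k) / 2) * (x ^ (2 * mid k) * weight k) \<le> A' * ?B x"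
      using x A' B \<open>0 \<le> A'\<close> weight_pos[of k] by (intro mult_mono) auto
    ultimately have "(real (mid k) * x ^ (2 * mid k) / 2) * (x ^ (2 * mid k) * weight k) / sqrt (weight k)
        \<le> (A' * ?B x + B' * ?A x) / sqrt (weight k)"
      using weight_pos[of k] by (intro divide_right_mono) auto
    moreover have "weight k / sqrt (weight k) = sqrt (weight k)"
      using weight_pos[of k] by (simp add: real_div_sqrt)
    moreover have "(real (mid k) * x ^ (2 * mid k) / 2) * (x ^ (2 * mid k) * weight k) / sqrt (weight k)
        = real (mid k) * x ^ (2 * mid k) * x ^ (2 * mid k) * (weight k / sqrt (weight k)) / 2"
      by simp
    ultimately show ?thesis
      by (simp only:)
  qed
  ultimately show ?thesis
    by (rule that)
qed

lemma symbol_block_operator_not_bloch: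
  "(\<lambda>z. dirichlet_symbol block_operator z z) \<notin> bloch" (is "?f \<notin> bloch")
proof
  assume "?f \<in> bloch"
  \<comment> \<open>Holomorphy comes with the assumed membership and supplies the derivative along
    the real axis.\<close>
  then have hol: "?f holomorphic_on ball 0 1"
    and "bdd_above ((\<lambda>z. (1 - (cmod z)\<^sup>2) * cmod (deriv ?f z)) ` ball 0 1)"
    by (simp_all add: bloch_def)
  then obtain B where "\<forall>y\<in>(\<lambda>z. (1 - (cmod z)\<^sup>2) * cmod (deriv ?f z)) ` ball 0 1. y \<le> B"
    unfolding bdd_above_def by blast
  then have B: "(1 - (cmod z)\<^sup>2) * cmod (deriv ?f z) \<le> B" if "cmod z < 1" for z
    using that by simp
  have weight_le: "sqrt (weight k) \<le> 32 * B" for k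
  proof -
    define M where "M = real (mid k)"
    \<comment> \<open>Exponents reach up to \<open>2 * M\<close>, and Bernoulli gives
      \<open>x ^ (2 * M) \<ge> 1 - 2 / 8 = 3 / 4\<close> at this distance from the boundary.\<close>
    define x where "x = 1 - 1 / (8 * M)"
    have M: "M \<ge> 1"
      using mid_pos[of k] by (simp add: M_def Suc_le_eq)
    then have x: "0 < x" "x < 1"
      by (auto simp: x_def field_simps)
    have "1 + real (2 * mid k) * (- (1 / (8 * M))) \<le> (1 + (- (1 / (8 * M)))) ^ (2 * mid k)"
      using M by (intro Bernoulli_inequality) (auto simp: field_simps)
    then have pow: "3 / 4 \<le> x ^ (2 * mid k)"
      using M by (simp add: x_def M_def)
    obtain D where D: "(block_term k has_real_derivative D) (at x)"
      and D_ge: "M * x ^ (2 * mid k) * x ^ (2 * mid k) * sqrt (weight k) / 2 \<le> D"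
      using block_term_derivative[of x k] x unfolding M_def by auto
    have "(?f has_field_derivative deriv ?f (of_real x)) (at (of_real x))"
      using x by (intro holomorphic_derivI[OF hol]) auto
    then have "((\<lambda>t. Re (?f (of_real t))) has_real_derivative Re (deriv ?f (of_real x))) (at x)"
      by (intro has_field_derivative_Re has_vector_derivative_real_field)
    then have "((\<lambda>t. Re (?f (of_real t)) - block_term k t) has_real_derivative Re (deriv ?f (of_real x)) - D) (at x)"
      using D by (rule DERIV_diff)
    \<comment> \<open>Removing the summand \<open>k\<close> leaves a nondecreasing function, so the
      derivative of the full symbol is at least that of the single summand.\<close>
    then have "0 \<le> Re (deriv ?f (of_real x)) - D"
      by (rule mono_on_imp_deriv_nonneg[OF mono_on_symbol_minus_block_term]) (use x in auto)
    then have "D \<le> cmod (deriv ?f (of_real x))"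
      using complex_Re_le_cmod[of "deriv ?f (of_real x)"] by linarith
    moreover have "M * sqrt (weight k) / 4 \<le> D"
    proof -
      \<comment> \<open>Here \<open>(3 / 4)\<^sup>2 = 9 / 16\<close> exceeds one half.\<close>
      have "1 / 2 \<le> x ^ (2 * mid k) * x ^ (2 * mid k)"
        using mult_mono[OF pow pow] x by simp
      then have "M * sqrt (weight k) / 2 * (1 / 2) \<le> M * sqrt (weight k) / 2 * (x ^ (2 * mid k) * x ^ (2 * mid k))"
        using M weight_pos[of k] by (intro mult_left_mono) auto
      then show ?thesis
        using D_ge by (simp add: mult_ac)
    qed
    ultimately have "M * sqrt (weight k) / 4 \<le> cmod (deriv ?f (of_real x))"
      by linarith
    moreover have "1 / (8 * M) \<le> 1 - x\<^sup>2"
    proof -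
      have "x\<^sup>2 \<le> x"
        using x by (simp add: power2_eq_square mult_left_le)
      then show ?thesis
        unfolding x_def by linarith
    qed
    \<comment> \<open>The size \<open>M\<close> of the block cancels, leaving
      \<open>sqrt (weight k) / 32\<close>; hence the constant 32.\<close>
    ultimately have "1 / (8 * M) * (M * sqrt (weight k) / 4) \<le> (1 - x\<^sup>2) * cmod (deriv ?f (of_real x))"
      using M weight_pos[of k] x by (intro mult_mono) (auto simp: power_le_one)
    also have "\<dots> \<le> B"
      using B[of "of_real x"] x by simp
    finally show ?thesis
      using M by simp
  qed
  \<comment> \<open>The bound holds for every \<open>k\<close>, whereas the weights exceed
    \<open>k\<close>.\<close>
  obtain k where k: "(32 * B)\<^sup>2 < real k"
    using reals_Archimedean2 by blast
  have "weight k = (sqrt (weight k))\<^sup>2"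
    using weight_pos[of k] by simp
  also have "\<dots> \<le> (32 * B)\<^sup>2"
    using weight_pos[of k] by (intro power_mono weight_le) auto
  finally show False
    using k weight_ge[of k] by simp
qed

theorem theorem1p10p2:
  shows "\<exists>f. f \<in> mock_bloch \<and> f \<notin> bloch"
proof (intro exI conjI)
  show "(\<lambda>z. dirichlet_symbol block_operator z z) \<in> mock_bloch"
    unfolding mock_bloch_def using bounded_operator_block_operator by auto
qed (rule symbol_block_operator_not_bloch)

end
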